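(* Let $\mathcal{H}, \mathcal{K}$ be closed subspaces of $L^2$ and let $a \in \mathscr{G}L^\infty$ with $a\mathcal{K} = \mathcal{H}$. Then the operators $$T_{a}^{\mathcal{K},\mathcal{H}} = M_a|_{\mathcal{K}} \quad\text{and}\quad T_{\bar a^{-1}}^{\mathcal{K},\mathcal{H}} = P_{\mathcal{H}}\, \bar a^{-1} P_{\mathcal{K}}|_{\mathcal{K}}$$ from $\mathcal{K}$ to $\mathcal{H}$ are invertible with $$(T_a^{\mathcal{K},\mathcal{H}})^{-1} = T_{a^{-1}}^{\mathcal{H},\mathcal{K}} \quad\text{and}\quad (T_{\bar a^{-1}}^{\mathcal{K},\mathcal{H}})^{-1} = T_{\bar a}^{\mathcal{H},\mathcal{K}},$$ which are generalized Toeplitz operators. Moreover, $$T_{\bar a^{-1}}^{\mathcal{K},\mathcal{H}} = \big[(T_a^{\mathcal{K},\mathcal{H}})^*\big]^{-1}.$$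
   Context: $L^2 = L^2(\mathbb{T}, m)$, with $m$ normalized Lebesgue measure on the unit circle $\mathbb{T}$, and $L^\infty = L^\infty(\mathbb{T},m)$ (complex-valued functions). $\mathscr{G}L^\infty = \{g \in L^\infty : 1/g \in L^\infty\}$. For $a\in L^\infty$, $M_a$ is the multiplication operator $f \mapsto af$ on $L^2$ (also written simply $a$ inside products of operators), and $a\mathcal{K} = \{af : f\in \mathcal{K}\}$. $P_{\mathcal{H}}$ is the orthogonal projection of $L^2$ onto the closed subspace $\mathcal{H}$. For closed subspaces $\mathcal{M}, \mathcal{N}$ of $L^2$ and $\phi \in L^\infty$, the generalized Toeplitz operator is $T_\phi^{\mathcal{M},\mathcal{N}} : \mathcal{M} \to \mathcal{N}$, $T_\phi^{\mathcal{M},\mathcal{N}} f = P_{\mathcal{N}}(\phi f)$. Invertible means boundedly invertible (bijective with bounded inverse). *)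

theory Defs
  imports "HOL-Analysis.Analysis"
begin

text \<open>Normalized Lebesgue measure on the unit circle: the completed image of the uniform
  distribution on \<open>[0, 2\<pi>)\<close> under \<open>t \<mapsto> e\<^sup>i\<^sup>t\<close>. Its underlying set is \<open>sphere 0 1\<close>, so values of
  functions off the circle are irrelevant.\<close>

definition circle_measure :: "complex measure" where
  "circle_measure =
     completion (distr (uniform_measure lborel {0..<2 * pi})
                       (restrict_space borel (sphere 0 1)) cis)"

definition square_integrable :: "(complex \<Rightarrow> complex) \<Rightarrow> bool" where
  "square_integrable f \<longleftrightarrow>
     f \<in> borel_measurable circle_measure \<and>
     integrable circle_measure (\<lambda>z. (cmod (f z))\<^sup>2)"

lemma square_integrable_zero: "square_integrable (\<lambda>z. 0)"
  by (simp add: square_integrable_def)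

lemma square_integrable_bound:
  assumes "g \<in> borel_measurable circle_measure"
    and "integrable circle_measure h"
    and "AE z in circle_measure. (cmod (g z))\<^sup>2 \<le> h z"
  shows "square_integrable g"
  unfolding square_integrable_def
proof
  show "integrable circle_measure (\<lambda>z. (cmod (g z))\<^sup>2)"
  proof (rule Bochner_Integration.integrable_bound[OF assms(2)])
    show "AE z in circle_measure. norm ((cmod (g z))\<^sup>2) \<le> norm (h z)"
      using assms(3) by eventually_elim auto
  qed (use assms(1) in measurable)
qed (fact assms(1))

lemma square_integrable_add:
  assumes "square_integrable f" "square_integrable g"
  shows "square_integrable (\<lambda>z. f z + g z)"
proof (rule square_integrable_bound)
  show "integrable circle_measure (\<lambda>z. 2 * (cmod (f z))\<^sup>2 + 2 * (cmod (g z))\<^sup>2)"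
    using assms by (auto simp: square_integrable_def)
  have "(cmod (u + v))\<^sup>2 \<le> 2 * (cmod u)\<^sup>2 + 2 * (cmod v)\<^sup>2" for u v
  proof -
    have "(cmod (u + v))\<^sup>2 \<le> (cmod u + cmod v)\<^sup>2"
      by (intro power_mono norm_triangle_ineq) auto
    also have "\<dots> \<le> 2 * (cmod u)\<^sup>2 + 2 * (cmod v)\<^sup>2"
      using zero_le_power2[of "cmod u - cmod v"] by (simp add: power2_eq_square algebra_simps)
    finally show ?thesis .
  qed
  then show "AE z in circle_measure. (cmod (f z + g z))\<^sup>2 \<le> 2 * (cmod (f z))\<^sup>2 + 2 * (cmod (g z))\<^sup>2"
    by simp
qed (use assms in \<open>auto simp: square_integrable_def\<close>)

lemma square_integrable_mult_bounded:
  assumes "p \<in> borel_measurable circle_measure"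
    and "AE z in circle_measure. cmod (p z) \<le> C" "square_integrable f"
  shows "square_integrable (\<lambda>z. p z * f z)"
proof (rule square_integrable_bound)
  show "integrable circle_measure (\<lambda>z. C\<^sup>2 * (cmod (f z))\<^sup>2)"
    using assms by (auto simp: square_integrable_def)
  show "AE z in circle_measure. (cmod (p z * f z))\<^sup>2 \<le> C\<^sup>2 * (cmod (f z))\<^sup>2"
    using assms(2)
    by eventually_elim (auto simp: norm_mult power_mult_distrib intro!: mult_right_mono power_mono)
qed (use assms in \<open>auto simp: square_integrable_def\<close>)

lemma square_integrable_cmult:
  "square_integrable f \<Longrightarrow> square_integrable (\<lambda>z. c * f z)"
  by (rule square_integrable_mult_bounded[where C = "cmod c"]) auto

lemma square_integrable_diff:
  assumes "square_integrable f" "square_integrable g"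
  shows "square_integrable (\<lambda>z. f z - g z)"
  using square_integrable_add[OF assms(1) square_integrable_cmult[OF assms(2), of "-1"]] by simp

lemma borel_measurable_cnj_l2:
  "f \<in> borel_measurable M \<Longrightarrow> (\<lambda>z. cnj (f z)) \<in> borel_measurable M"
  by (rule borel_measurable_continuous_on[of cnj]) (auto intro: continuous_intros)

lemma integrable_mult_cnj:
  assumes "square_integrable f" "square_integrable g"
  shows "integrable circle_measure (\<lambda>z. f z * cnj (g z))"
proof (rule Bochner_Integration.integrable_bound)
  show "integrable circle_measure (\<lambda>z. (cmod (f z))\<^sup>2 + (cmod (g z))\<^sup>2)"
    using assms by (auto simp: square_integrable_def)
  have "cmod (u * cnj v) \<le> (cmod u)\<^sup>2 + (cmod v)\<^sup>2" for u v
  proof -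
    have "2 * (cmod u * cmod v) \<le> (cmod u)\<^sup>2 + (cmod v)\<^sup>2"
      using zero_le_power2[of "cmod u - cmod v"] by (simp add: power2_eq_square algebra_simps)
    moreover have "0 \<le> cmod u * cmod v" by simp
    ultimately show ?thesis unfolding norm_mult complex_mod_cnj by linarith
  qed
  then show "AE z in circle_measure. norm (f z * cnj (g z)) \<le> norm ((cmod (f z))\<^sup>2 + (cmod (g z))\<^sup>2)"
    by simp
qed (use assms in \<open>auto simp: square_integrable_def intro!: borel_measurable_times borel_measurable_cnj_l2\<close>)

definition l2_rel :: "(complex \<Rightarrow> complex) \<Rightarrow> (complex \<Rightarrow> complex) \<Rightarrow> bool" where
  "l2_rel f g \<longleftrightarrow>
     square_integrable f \<and> square_integrable g \<and> (AE z in circle_measure. f z = g z)"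

quotient_type l2 = "complex \<Rightarrow> complex" / partial: l2_rel
proof (rule part_equivpI)
  show "\<exists>f. l2_rel f f"
    using square_integrable_zero by (auto simp: l2_rel_def)
  show "symp l2_rel"
    by (auto simp: symp_def l2_rel_def elim: AE_mp)
  show "transp l2_rel"
    by (auto simp: transp_def l2_rel_def elim: AE_mp)
qed

lift_definition scaleC :: "complex \<Rightarrow> l2 \<Rightarrow> l2" is "\<lambda>c f z. c * f z"
  by (auto simp: l2_rel_def square_integrable_cmult)

lift_definition cinner :: "l2 \<Rightarrow> l2 \<Rightarrow> complex"
  is "\<lambda>f g. (LINT z|circle_measure. f z * cnj (g z))"
proof -
  fix f f' g g' assume "l2_rel f f'" "l2_rel g g'"
  then show "(LINT z|circle_measure. f z * cnj (g z)) = (LINT z|circle_measure. f' z * cnj (g' z))"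
    by (intro integral_cong_AE)
       (auto simp: l2_rel_def square_integrable_def
             intro!: borel_measurable_times borel_measurable_cnj_l2)
qed

instantiation l2 :: real_vector
begin

lift_definition zero_l2 :: l2 is "\<lambda>z. 0"
  by (simp add: l2_rel_def square_integrable_zero)

lift_definition plus_l2 :: "l2 \<Rightarrow> l2 \<Rightarrow> l2" is "\<lambda>f g z. f z + g z"
  by (auto simp: l2_rel_def square_integrable_add)

lift_definition minus_l2 :: "l2 \<Rightarrow> l2 \<Rightarrow> l2" is "\<lambda>f g z. f z - g z"
  by (auto simp: l2_rel_def square_integrable_diff)

lift_definition uminus_l2 :: "l2 \<Rightarrow> l2" is "\<lambda>f z. - f z"
  using square_integrable_cmult[of _ "-1"] by (auto simp: l2_rel_def)

definition scaleR_l2 :: "real \<Rightarrow> l2 \<Rightarrow> l2" where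
  "scaleR_l2 r f = scaleC (complex_of_real r) f"

instance
proof
  fix f g h :: l2 and r s :: real
  show "f + g + h = f + (g + h)"
    by transfer (auto simp: l2_rel_def add.assoc square_integrable_add)
  show "f + g = g + f"
    by transfer (auto simp: l2_rel_def add.commute square_integrable_add)
  show "0 + f = f"
    by transfer (auto simp: l2_rel_def)
  show "- f + f = 0"
    by transfer (auto simp: l2_rel_def square_integrable_zero)
  show "f - g = f + - g"
    by transfer (auto simp: l2_rel_def square_integrable_diff)
  show "r *\<^sub>R (f + g) = r *\<^sub>R f + r *\<^sub>R g" unfolding scaleR_l2_def
    by transfer (auto simp: l2_rel_def square_integrable_add square_integrable_cmult ring_distribs)
  show "(r + s) *\<^sub>R f = r *\<^sub>R f + s *\<^sub>R f" unfolding scaleR_l2_def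
    by transfer (auto simp: l2_rel_def square_integrable_add square_integrable_cmult ring_distribs)
  show "r *\<^sub>R s *\<^sub>R f = (r * s) *\<^sub>R f" unfolding scaleR_l2_def
    by transfer (auto simp: l2_rel_def square_integrable_cmult mult.assoc)
  show "1 *\<^sub>R f = f" unfolding scaleR_l2_def
    by transfer (auto simp: l2_rel_def)
qed

end

instantiation l2 :: real_inner
begin

definition inner_l2 :: "l2 \<Rightarrow> l2 \<Rightarrow> real" where
  "inner_l2 f g = Re (cinner f g)"

definition norm_l2 :: "l2 \<Rightarrow> real" where
  "norm_l2 f = sqrt (inner f f)"

definition sgn_l2 :: "l2 \<Rightarrow> l2" where
  "sgn_l2 f = f /\<^sub>R norm f"

definition dist_l2 :: "l2 \<Rightarrow> l2 \<Rightarrow> real" where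
  "dist_l2 f g = norm (f - g)"

definition uniformity_l2 :: "(l2 \<times> l2) filter" where
  "uniformity_l2 = (INF e\<in>{0 <..}. principal {(f, g). dist f g < e})"

definition open_l2 :: "l2 set \<Rightarrow> bool" where
  "open_l2 U \<longleftrightarrow> (\<forall>x\<in>U. eventually (\<lambda>(x', y). x' = x \<longrightarrow> y \<in> U) uniformity)"

instance
proof
  fix f g h :: l2 and r :: real and U :: "l2 set"
  show "dist f g = norm (f - g)" "sgn f = f /\<^sub>R norm f" "norm f = sqrt (inner f f)"
    by (simp_all add: dist_l2_def sgn_l2_def norm_l2_def)
  show "uniformity = (INF e\<in>{0 <..}. principal {(f::l2, g). dist f g < e})"
    by (rule uniformity_l2_def)
  show "open U \<longleftrightarrow> (\<forall>x\<in>U. eventually (\<lambda>(x', y). x' = x \<longrightarrow> y \<in> U) uniformity)"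
    by (rule open_l2_def)
  show "inner f g = inner g f" unfolding inner_l2_def
  proof transfer
    fix f g assume "l2_rel f f" "l2_rel g g"
    have "(LINT z|circle_measure. f z * cnj (g z)) = (LINT z|circle_measure. cnj (g z * cnj (f z)))"
      by (simp add: mult.commute)
    also have "\<dots> = cnj (LINT z|circle_measure. g z * cnj (f z))"
      by (rule Bochner_Integration.integral_cnj)
    finally show "Re (LINT z|circle_measure. f z * cnj (g z)) = Re (LINT z|circle_measure. g z * cnj (f z))"
      by simp
  qed
  show "inner (f + g) h = inner f h + inner g h" unfolding inner_l2_def
    by transfer (auto simp: l2_rel_def ring_distribs integrable_mult_cnj)
  show "inner (r *\<^sub>R f) g = r * inner f g" unfolding inner_l2_def scaleR_l2_def
    by transfer (simp add: mult.assoc)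
  have nn: "Re (LINT z|circle_measure. k z * cnj (k z)) = (LINT z|circle_measure. (cmod (k z))\<^sup>2)"
    if "square_integrable k" for k
  proof -
    have "(LINT z|circle_measure. k z * cnj (k z)) = (LINT z|circle_measure. complex_of_real ((cmod (k z))\<^sup>2))"
      by (intro Bochner_Integration.integral_cong refl) (simp flip: complex_norm_square)
    then show ?thesis by (simp only: integral_complex_of_real Re_complex_of_real)
  qed
  show "0 \<le> inner f f" unfolding inner_l2_def
    by transfer (simp add: nn l2_rel_def)
  show "inner f f = 0 \<longleftrightarrow> f = 0" unfolding inner_l2_def
  proof transfer
    fix k assume "l2_rel k k"
    then have k: "square_integrable k" by (simp add: l2_rel_def)
    then have "(LINT z|circle_measure. (cmod (k z))\<^sup>2) = 0 \<longleftrightarrow>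
        (AE z in circle_measure. (cmod (k z))\<^sup>2 = 0)"
      by (intro integral_nonneg_eq_0_iff_AE) (auto simp: square_integrable_def)
    then show "Re (LINT z|circle_measure. k z * cnj (k z)) = 0 \<longleftrightarrow> l2_rel k (\<lambda>z. 0)"
      using k square_integrable_zero by (simp add: nn l2_rel_def)
  qed
qed

end

definition Linf :: "(complex \<Rightarrow> complex) set" where
  "Linf = {p \<in> borel_measurable circle_measure.
             \<exists>C. AE z in circle_measure. cmod (p z) \<le> C}"

text \<open>Since \<open>1 / 0 = 0\<close> in HOL, almost everywhere nonvanishing has to be demanded separately
  for \<open>1 / g\<close> to be the intended function.\<close>

definition GLinf :: "(complex \<Rightarrow> complex) set" where
  "GLinf = {g \<in> Linf. (AE z in circle_measure. g z \<noteq> 0) \<and> (\<lambda>z. 1 / g z) \<in> Linf}"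

text \<open>Symbols are representatives of classes in \<open>L\<^sup>\<infinity>\<close>; the value \<open>0\<close> for symbols outside
  \<^const>\<open>Linf\<close> only makes the operator total.\<close>

lift_definition mult_op :: "(complex \<Rightarrow> complex) \<Rightarrow> l2 \<Rightarrow> l2"
  is "\<lambda>p f z. if p \<in> Linf then p z * f z else 0"
proof -
  fix p f f' assume "l2_rel f f'"
  show "l2_rel (\<lambda>z. if p \<in> Linf then p z * f z else 0) (\<lambda>z. if p \<in> Linf then p z * f' z else 0)"
  proof (cases "p \<in> Linf")
    case True
    then obtain C where "p \<in> borel_measurable circle_measure" "AE z in circle_measure. cmod (p z) \<le> C"
      by (auto simp: Linf_def)
    with \<open>l2_rel f f'\<close> True show ?thesis
      by (auto simp: l2_rel_def intro: square_integrable_mult_bounded)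
  qed (simp add: l2_rel_def square_integrable_zero)
qed

definition closed_csubspace :: "l2 set \<Rightarrow> bool" where
  "closed_csubspace S \<longleftrightarrow> closed S \<and> 0 \<in> S \<and>
     (\<forall>f\<in>S. \<forall>g\<in>S. f + g \<in> S) \<and> (\<forall>c. \<forall>f\<in>S. scaleC c f \<in> S)"

text \<open>The descriptions in \<open>orth_proj\<close> and \<open>adjoint_op\<close> below are meaningful only for closed
  subspaces (and bounded operators between them), where existence and uniqueness hold because
  \<open>L\<^sup>2\<close> is a Hilbert space.\<close>

definition orth_proj :: "l2 set \<Rightarrow> l2 \<Rightarrow> l2" where
  "orth_proj S f = (THE g. g \<in> S \<and> (\<forall>h\<in>S. cinner (f - g) h = 0))"

text \<open>Operators between subspaces \<open>M\<close> and \<open>N\<close> are extensional functions on \<open>M\<close> (undefined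
  outside \<open>M\<close>), so that \<open>=\<close> is equality of operators \<open>M \<rightarrow> N\<close>.\<close>

definition bounded_op :: "l2 set \<Rightarrow> l2 set \<Rightarrow> (l2 \<Rightarrow> l2) \<Rightarrow> bool" where
  "bounded_op M N T \<longleftrightarrow> T \<in> M \<rightarrow>\<^sub>E N \<and>
     (\<forall>f\<in>M. \<forall>g\<in>M. T (f + g) = T f + T g) \<and>
     (\<forall>c. \<forall>f\<in>M. T (scaleC c f) = scaleC c (T f)) \<and>
     (\<exists>C. \<forall>f\<in>M. norm (T f) \<le> C * norm f)"

definition inverse_op :: "l2 set \<Rightarrow> l2 set \<Rightarrow> (l2 \<Rightarrow> l2) \<Rightarrow> l2 \<Rightarrow> l2" where
  "inverse_op M N T = restrict (inv_into M T) N"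

definition invertible_op :: "l2 set \<Rightarrow> l2 set \<Rightarrow> (l2 \<Rightarrow> l2) \<Rightarrow> bool" where
  "invertible_op M N T \<longleftrightarrow>
     bounded_op M N T \<and> bij_betw T M N \<and> bounded_op N M (inverse_op M N T)"

definition adjoint_op :: "l2 set \<Rightarrow> l2 set \<Rightarrow> (l2 \<Rightarrow> l2) \<Rightarrow> l2 \<Rightarrow> l2" where
  "adjoint_op M N T = (\<lambda>g\<in>N. THE h. h \<in> M \<and> (\<forall>f\<in>M. cinner (T f) g = cinner f h))"

definition gen_toeplitz :: "l2 set \<Rightarrow> l2 set \<Rightarrow> (complex \<Rightarrow> complex) \<Rightarrow> l2 \<Rightarrow> l2" where
  "gen_toeplitz M N p = (\<lambda>f\<in>M. orth_proj N (mult_op p f))"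

end

theory Submission imports Defs begin

text \<open>The identities are consequences of the adjoint relation \<open>\<langle>p f, g\<rangle> = \<langle>f, cnj p g\<rangle>\<close>.
  Since \<open>a K = H\<close>, multiplication by \<open>a\<close> already maps \<open>K\<close> onto \<open>H\<close>, with inverse multiplication
  by \<open>1 / a\<close>, and the projections act as the identity (\<open>gen_toeplitz_eq_mult_op\<close>). For the conjugate symbols,
  multiplication by \<open>1 / cnj a\<close> carries the orthogonal complement of \<open>K\<close> into that of \<open>H\<close>:
  if \<open>u\<close> is orthogonal to \<open>K\<close>, then \<open>\<langle>u / cnj a, a k\<rangle> = \<langle>u, k\<rangle> = 0\<close> for \<open>k \<in> K\<close>. Hence replacing
  \<open>cnj a f\<close> by its projection to \<open>K\<close> changes \<open>f = (1 / cnj a) (cnj a f)\<close> only by something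
  orthogonal to \<open>H\<close>, and a projection to \<open>H\<close> recovers \<open>f\<close> (\<open>gen_toeplitz_cnj_left_inverse\<close>).
  The hypotheses are symmetric under exchanging \<open>(a, K, H)\<close> with \<open>(1 / a, H, K)\<close>, and so this
  one-sided inverse is two-sided. Finally the adjoint of \<open>T\<^sub>p\<close> is \<open>T\<close> with symbol \<open>cnj p\<close>
  (\<open>adjoint_gen_toeplitz\<close>), which identifies the last operator.

  All of this presupposes that orthogonal projections onto closed subspaces exist, which rests on the
  Riesz--Fischer theorem: the space of square-integrable functions is complete. Its proof extracts a
  rapidly Cauchy subsequence, which converges almost everywhere, and applies Fatou's lemma.\<close>

section \<open>Completeness of the space of square-integrable functions\<close>

lemma l2_cases:
  obtains f where "square_integrable f" "x = abs_l2 f"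
proof -
  have "l2_rel (rep_l2 x) (rep_l2 x)" "x = abs_l2 (rep_l2 x)"
    by (simp_all only: Quotient3_rep_reflp[OF Quotient3_l2] Quotient3_abs_rep[OF Quotient3_l2])
  then show ?thesis using that by (auto simp: l2_rel_def)
qed

lemma l2_rel_refl: "square_integrable f \<Longrightarrow> l2_rel f f"
  by (simp add: l2_rel_def)

lemma abs_l2_diff:
  "square_integrable f \<Longrightarrow> square_integrable g \<Longrightarrow> abs_l2 f - abs_l2 g = abs_l2 (\<lambda>z. f z - g z)"
  by (simp add: minus_l2.abs_eq l2_rel_refl)

lemma nn_integral_norm_l2:
  assumes "square_integrable f"
  shows "(\<integral>\<^sup>+ z. ennreal ((cmod (f z))\<^sup>2) \<partial>circle_measure) = ennreal ((norm (abs_l2 f))\<^sup>2)"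
proof -
  have "(norm (abs_l2 f))\<^sup>2 = Re (cinner (abs_l2 f) (abs_l2 f))"
    by (simp add: power2_norm_eq_inner inner_l2_def)
  also have "\<dots> = Re (LINT z|circle_measure. f z * cnj (f z))"
    using assms by (simp add: cinner.abs_eq l2_rel_refl)
  also have "(LINT z|circle_measure. f z * cnj (f z))
      = (LINT z|circle_measure. complex_of_real ((cmod (f z))\<^sup>2))"
    by (intro Bochner_Integration.integral_cong refl) (simp flip: complex_norm_square)
  also have "Re \<dots> = (LINT z|circle_measure. (cmod (f z))\<^sup>2)"
    by (simp only: integral_complex_of_real Re_complex_of_real)
  finally show ?thesis
    using assms by (subst nn_integral_eq_integral) (auto simp: square_integrable_def)
qed

text \<open>A geometric bound on the square integrals of the terms forces absolute convergence almost
  everywhere. The weights \<open>4 ^ n\<close> still leave a convergent series of integrals, so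
  \<open>4 ^ n * (cmod (d n z))\<^sup>2\<close> is bounded in \<open>n\<close> for almost every \<open>z\<close>, and then \<open>cmod (d n z)\<close> is
  dominated by a multiple of \<open>(1 / 2) ^ n\<close>.\<close>

lemma AE_summable_if_square_integrals_geometric:
  fixes d :: "nat \<Rightarrow> 'a \<Rightarrow> complex"
  assumes [measurable]: "\<And>n. d n \<in> borel_measurable M"
    and bound: "\<And>n. (\<integral>\<^sup>+ z. ennreal ((cmod (d n z))\<^sup>2) \<partial>M) \<le> ennreal (((1/4)^n)\<^sup>2)"
  shows "AE z in M. summable (\<lambda>n. d n z)"
proof -
  have "(\<integral>\<^sup>+ z. (\<Sum>n. ennreal (4^n * (cmod (d n z))\<^sup>2)) \<partial>M)
      = (\<Sum>n. \<integral>\<^sup>+ z. ennreal (4^n * (cmod (d n z))\<^sup>2) \<partial>M)"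
    by (rule nn_integral_suminf) measurable
  also have "\<dots> \<le> (\<Sum>n. ennreal ((1/4)^n))"
  proof (rule suminf_le)
    fix n
    have "(\<integral>\<^sup>+ z. ennreal (4^n * (cmod (d n z))\<^sup>2) \<partial>M)
        = ennreal (4^n) * (\<integral>\<^sup>+ z. ennreal ((cmod (d n z))\<^sup>2) \<partial>M)"
      by (subst nn_integral_cmult[symmetric]) (auto simp: ennreal_mult)
    also have "\<dots> \<le> ennreal (4^n) * ennreal (((1/4)^n)\<^sup>2)"
      by (intro mult_left_mono bound) auto
    also have "\<dots> = ennreal ((1/4)^n)"
      by (subst ennreal_mult[symmetric]) (auto simp: power2_eq_square power_one_over)
    finally show "(\<integral>\<^sup>+ z. ennreal (4^n * (cmod (d n z))\<^sup>2) \<partial>M) \<le> ennreal ((1/4)^n)" .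
  qed auto
  also have "\<dots> < \<infinity>"
    by (subst suminf_ennreal2) (auto intro!: summable_geometric)
  finally have "(\<integral>\<^sup>+ z. (\<Sum>n. ennreal (4^n * (cmod (d n z))\<^sup>2)) \<partial>M) \<noteq> \<infinity>"
    by simp
  then have "AE z in M. (\<Sum>n. ennreal (4^n * (cmod (d n z))\<^sup>2)) \<noteq> \<infinity>"
    by (intro nn_integral_PInf_AE) auto
  then show ?thesis
  proof eventually_elim
    case (elim z)
    then have summ: "summable (\<lambda>n. 4^n * (cmod (d n z))\<^sup>2)"
      by (intro summable_suminf_not_top) auto
    define C where "C = (\<Sum>n. 4^n * (cmod (d n z))\<^sup>2)"
    have "norm (d n z) \<le> sqrt C * (1/2)^n" for n
    proof -
      have "4^n * (cmod (d n z))\<^sup>2 \<le> C"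
        unfolding C_def using sum_le_suminf[OF summ, of "{n}"] by simp
      moreover have "4^n * (cmod (d n z))\<^sup>2 = (2^n * cmod (d n z))\<^sup>2"
      proof -
        have "(4::real)^n = (2^n)\<^sup>2" by (simp add: power2_eq_square flip: power_mult_distrib)
        then show ?thesis by (simp add: power_mult_distrib)
      qed
      ultimately have "2^n * cmod (d n z) \<le> sqrt C"
        by (intro real_le_rsqrt) simp
      then show ?thesis by (simp add: field_simps)
    qed
    moreover have "summable (\<lambda>n. sqrt C * (1/2)^n)"
      by (rule summable_mult[OF summable_geometric]) simp
    ultimately show ?case
      by (rule summable_comparison_test'[rotated])
  qed
qed

text \<open>Riesz--Fischer theorem.\<close>

instance l2 :: complete_space
proof
  fix X :: "nat \<Rightarrow> l2"
  assume "Cauchy X"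
  then have "\<exists>N. \<forall>m\<ge>N. \<forall>k\<ge>N. dist (X m) (X k) < (1/4)^n" for n
    by (auto simp: Cauchy_def)
  then obtain N where N: "\<And>n m k. m \<ge> N n \<Longrightarrow> k \<ge> N n \<Longrightarrow> dist (X m) (X k) < (1/4)^n"
    by metis
  \<comment> \<open>Partial sums dominate every earlier \<open>N i\<close>, so consecutive indices \<open>r n\<close>, \<open>r (Suc n)\<close> both lie
      beyond \<open>N n\<close>.\<close>
  define r where "r n = (\<Sum>i\<le>n. N i)" for n
  have r: "r n \<ge> N i" if "i \<le> n" for i n
    unfolding r_def using that by (intro member_le_sum) auto
  have "\<exists>f. square_integrable f \<and> X n = abs_l2 f" for n
    by (metis l2_cases)
  then obtain f where sq: "\<And>n. square_integrable (f n)" and X: "\<And>n. X n = abs_l2 (f n)"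
    by metis
  have [measurable]: "f n \<in> borel_measurable circle_measure" for n
    using sq[of n] by (simp add: square_integrable_def)
  have int_diff: "(\<integral>\<^sup>+ z. ennreal ((cmod (f k z - f m z))\<^sup>2) \<partial>circle_measure) \<le> ennreal (((1/4)^n)\<^sup>2)"
    if "k \<ge> N n" "m \<ge> N n" for k m n
  proof -
    have "(\<integral>\<^sup>+ z. ennreal ((cmod (f k z - f m z))\<^sup>2) \<partial>circle_measure)
        = ennreal ((norm (X k - X m))\<^sup>2)"
      using nn_integral_norm_l2[OF square_integrable_diff[OF sq[of k] sq[of m]]]
      by (simp add: X abs_l2_diff sq)
    also have "\<dots> \<le> ennreal (((1/4)^n)\<^sup>2)"
      using N[OF that] by (intro ennreal_leI power_mono) (auto simp: dist_norm)
    finally show ?thesis .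
  qed
  have "AE z in circle_measure. summable (\<lambda>n. f (r (Suc n)) z - f (r n) z)"
    by (intro AE_summable_if_square_integrals_geometric int_diff r) auto
  then have conv: "AE z in circle_measure. (\<lambda>n. f (r n) z) \<longlonglongrightarrow> lim (\<lambda>n. f (r n) z)"
  proof eventually_elim
    case (elim z)
    then have "convergent (\<lambda>n. \<Sum>i<n. f (r (Suc i)) z - f (r i) z)"
      by (simp add: summable_iff_convergent)
    then have "convergent (\<lambda>n. (f (r n) z - f (r 0) z) + f (r 0) z)"
      unfolding sum_lessThan_telescope[of "\<lambda>i. f (r i) z"] by (intro convergent_add convergent_const)
    then show ?case by (simp add: convergent_LIMSEQ_iff)
  qed
  define F where "F z = lim (\<lambda>n. f (r n) z)" for z
  have [measurable]: "F \<in> borel_measurable circle_measure"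
    unfolding F_def by measurable
  \<comment> \<open>Almost everywhere convergence along \<open>r\<close> alone controls no integral; applying Fatou's lemma
      in the second index of the Cauchy estimate gives convergence of the whole sequence.\<close>
  have fatou: "(\<integral>\<^sup>+ z. ennreal ((cmod (f k z - F z))\<^sup>2) \<partial>circle_measure) \<le> ennreal (((1/4)^n)\<^sup>2)"
    if "k \<ge> N n" for k n
  proof -
    have "(\<integral>\<^sup>+ z. ennreal ((cmod (f k z - F z))\<^sup>2) \<partial>circle_measure)
        = (\<integral>\<^sup>+ z. liminf (\<lambda>m. ennreal ((cmod (f k z - f (r m) z))\<^sup>2)) \<partial>circle_measure)"
    proof (rule nn_integral_cong_AE, use conv in eventually_elim)
      case (elim z)
      then have "(\<lambda>m. ennreal ((cmod (f k z - f (r m) z))\<^sup>2)) \<longlonglongrightarrow> ennreal ((cmod (f k z - F z))\<^sup>2)"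
        unfolding F_def by (intro tendsto_ennrealI tendsto_intros)
      then show ?case by (intro lim_imp_Liminf[symmetric]) auto
    qed
    also have "\<dots> \<le> liminf (\<lambda>m. \<integral>\<^sup>+ z. ennreal ((cmod (f k z - f (r m) z))\<^sup>2) \<partial>circle_measure)"
      by (rule nn_integral_liminf) measurable
    also have "\<dots> \<le> liminf (\<lambda>m. ennreal (((1/4)^n)\<^sup>2))"
      by (intro Liminf_mono eventually_sequentiallyI[of n] int_diff that r)
    also have "\<dots> = ennreal (((1/4)^n)\<^sup>2)"
      by (simp add: Liminf_const)
    finally show ?thesis .
  qed
  have sq_diff: "square_integrable (\<lambda>z. f k z - F z)" if "k \<ge> N n" for k n
    unfolding square_integrable_def
    using le_less_trans[OF fatou[OF that]] by (auto intro!: integrableI_bounded)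
  have sqF: "square_integrable F"
    using square_integrable_diff[OF sq[of "N 0"] sq_diff[where n = 0 and k = "N 0"]] by simp
  have near: "norm (X k - abs_l2 F) \<le> (1/4)^n" if "k \<ge> N n" for k n
  proof -
    have "ennreal ((norm (X k - abs_l2 F))\<^sup>2) \<le> ennreal (((1/4)^n)\<^sup>2)"
      using fatou[OF that] nn_integral_norm_l2[OF sq_diff[OF that]] by (simp add: X abs_l2_diff sq sqF)
    then show ?thesis
      by (auto intro: power2_le_imp_le)
  qed
  have "X \<longlonglongrightarrow> abs_l2 F"
  proof (rule metric_LIMSEQ_I)
    fix e :: real assume "e > 0"
    then obtain n where "(1/4)^n < e"
      using real_arch_pow_inv[of e "1/4"] by auto
    then show "\<exists>M. \<forall>k\<ge>M. dist (X k) (abs_l2 F) < e"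
      using near[of n] by (auto simp: dist_norm intro!: exI[of _ "N n"] intro: le_less_trans)
  qed
  then show "convergent X"
    by (auto simp: convergent_def)
qed

section \<open>Orthogonal projections\<close>

lemma parallelogram_law:
  fixes x y :: "'a :: real_inner"
  shows "(norm (x - y))\<^sup>2 + (norm (x + y))\<^sup>2 = 2 * (norm x)\<^sup>2 + 2 * (norm y)\<^sup>2"
  by (simp add: power2_norm_eq_inner inner_add_left inner_add_right inner_diff_left inner_diff_right
      inner_commute)

text \<open>The foot of the perpendicular is the limit of a minimizing sequence for the distance. The
  parallelogram law turns near-minimality into a Cauchy estimate, because the midpoint of two
  points of \<open>S\<close> is in \<open>S\<close> and hence no closer than the infimum; at the minimum, the quadratic
  \<open>t \<mapsto> (norm (f - g - t *\<^sub>R h))\<^sup>2\<close> has no linear term.\<close>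

lemma orthogonal_projection_exists:
  fixes S :: "'a :: {real_inner, complete_space} set"
  assumes "closed S" "subspace S"
  obtains g where "g \<in> S" "\<And>h. h \<in> S \<Longrightarrow> inner (f - g) h = 0"
proof -
  define D where "D = (INF s\<in>S. (norm (f - s))\<^sup>2)"
  have bdd: "bdd_below ((\<lambda>s. (norm (f - s))\<^sup>2) ` S)"
    by (rule bdd_belowI2[of _ 0]) simp
  have ne: "S \<noteq> {}"
    using subspace_0[OF assms(2)] by blast
  have D_le: "D \<le> (norm (f - s))\<^sup>2" if "s \<in> S" for s
    unfolding D_def by (rule cINF_lower[OF bdd that])
  have "\<exists>s\<in>S. (norm (f - s))\<^sup>2 < D + inverse (real (Suc n))" for n
    using cINF_less_iff[OF ne bdd, of "D + inverse (real (Suc n))"] by (simp add: D_def)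
  then obtain s where s: "\<And>n. s n \<in> S" "\<And>n. (norm (f - s n))\<^sup>2 < D + inverse (real (Suc n))"
    by metis
  have close: "(norm (s m - s n))\<^sup>2 \<le> 2 * inverse (real (Suc m)) + 2 * inverse (real (Suc n))" for m n
  proof -
    have "(1/2) *\<^sub>R (s m + s n) \<in> S"
      using s(1) assms(2) by (simp add: subspace_add subspace_scale)
    from D_le[OF this] have "4 * D \<le> (norm (2 *\<^sub>R (f - (1/2) *\<^sub>R (s m + s n))))\<^sup>2"
      by (simp add: power_mult_distrib)
    also have "2 *\<^sub>R (f - (1/2) *\<^sub>R (s m + s n)) = (f - s n) + (f - s m)"
      by (simp add: algebra_simps scaleR_2)
    finally show ?thesis
      using parallelogram_law[of "f - s n" "f - s m"] s(2)[of m] s(2)[of n] by simp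
  qed
  have "Cauchy s"
  proof (rule metric_CauchyI)
    fix e :: real assume "e > 0"
    then obtain M where M: "inverse (real (Suc M)) < e\<^sup>2 / 4"
      using reals_Archimedean[of "e\<^sup>2 / 4"] by auto
    have "dist (s m) (s n) < e" if "m \<ge> M" "n \<ge> M" for m n
    proof -
      have "inverse (real (Suc m)) \<le> inverse (real (Suc M))" "inverse (real (Suc n)) \<le> inverse (real (Suc M))"
        using that by (auto intro!: le_imp_inverse_le)
      with close[of m n] M have "(norm (s m - s n))\<^sup>2 < e\<^sup>2" by linarith
      then show ?thesis
        using \<open>e > 0\<close> by (auto simp: dist_norm intro: power2_less_imp_less)
    qed
    then show "\<exists>M. \<forall>m\<ge>M. \<forall>n\<ge>M. dist (s m) (s n) < e" by blast
  qed
  then obtain g where g: "s \<longlonglongrightarrow> g"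
    using Cauchy_convergent convergent_def by blast
  have "g \<in> S"
    using closed_sequentially[OF assms(1) _ g] s(1) by blast
  have "(\<lambda>n. (norm (f - s n))\<^sup>2) \<longlonglongrightarrow> (norm (f - g))\<^sup>2"
    by (intro tendsto_intros g)
  moreover have "(\<lambda>n. D + inverse (real (Suc n))) \<longlonglongrightarrow> D"
    using LIMSEQ_inverse_real_of_nat_add .
  ultimately have min: "(norm (f - g))\<^sup>2 \<le> D"
    by (rule LIMSEQ_le) (use s(2) less_imp_le in blast)
  have "inner (f - g) h = 0" if "h \<in> S" for h
  proof (cases "h = 0")
    case False
    \<comment> \<open>The step that minimizes \<open>t \<mapsto> (norm (f - g - t *\<^sub>R h))\<^sup>2\<close>.\<close>
    define t where "t = inner (f - g) h / inner h h"
    have "g + t *\<^sub>R h \<in> S"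
      using assms(2) \<open>g \<in> S\<close> that by (simp add: subspace_add subspace_scale)
    from order_trans[OF min D_le[OF this]]
    have "inner (f - g) (f - g) \<le> inner ((f - g) - t *\<^sub>R h) ((f - g) - t *\<^sub>R h)"
      by (simp add: power2_norm_eq_inner diff_diff_eq)
    also have "\<dots> = inner (f - g) (f - g) - 2 * t * inner (f - g) h + t * t * inner h h"
      by (simp add: inner_diff_left inner_diff_right inner_commute[of h f] inner_commute[of h g]
          algebra_simps)
    also have "\<dots> = inner (f - g) (f - g) - (inner (f - g) h)\<^sup>2 / inner h h"
      using False by (simp add: t_def field_simps power2_eq_square)
    finally have "(inner (f - g) h)\<^sup>2 / inner h h \<le> 0" by simp
    moreover have "inner h h > 0" using False by simp
    ultimately show ?thesis
      by (simp add: divide_le_0_iff)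
  qed simp
  with \<open>g \<in> S\<close> show ?thesis using that by blast
qed

lemma cinner_add_left: "cinner (x + y) z = cinner x z + cinner y z"
  by transfer (auto simp: l2_rel_def ring_distribs integrable_mult_cnj)

lemma cinner_scaleC_left: "cinner (scaleC c x) y = c * cinner x y"
  by transfer (simp add: mult.assoc)

lemma cinner_commute: "cinner x y = cnj (cinner y x)"
proof -
  have "(LINT z|circle_measure. f z * cnj (g z)) = cnj (LINT z|circle_measure. g z * cnj (f z))" for f g
    unfolding Bochner_Integration.integral_cnj[symmetric] by (simp add: mult.commute)
  then show ?thesis by transfer
qed

lemma scaleC_uminus: "scaleC (- 1) x = - x"
  by transfer (auto simp: l2_rel_def intro: square_integrable_cmult[of _ "-1", simplified])

lemma cinner_diff_left: "cinner (x - y) z = cinner x z - cinner y z"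
  using cinner_add_left[of x "- y" z] cinner_scaleC_left[of "-1" y z] by (simp add: scaleC_uminus)

lemma cinner_zero_left: "cinner 0 z = 0"
  using cinner_diff_left[of 0 0 z] by simp

lemma cinner_diff_right: "cinner x (y - z) = cinner x y - cinner x z"
  by (subst (1 2 3) cinner_commute) (simp add: cinner_diff_left)

lemma cinner_self_eq_0: "cinner x x = 0 \<Longrightarrow> x = 0"
  using inner_eq_zero_iff[of x] by (simp add: inner_l2_def)

lemma scaleC_diff: "scaleC c (x - y) = scaleC c x - scaleC c y"
  by transfer
    (auto simp: l2_rel_def ring_distribs intro!: square_integrable_diff square_integrable_cmult)

lemma closed_csubspace_diff:
  assumes "closed_csubspace S" "x \<in> S" "y \<in> S"
  shows "x - y \<in> S"
  using assms scaleC_uminus[of y] unfolding closed_csubspace_def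
  by (metis diff_conv_add_uminus)

lemma closed_csubspace_imp_subspace: "closed_csubspace S \<Longrightarrow> subspace S"
  by (auto simp: closed_csubspace_def subspace_def scaleR_l2_def)

lemma orth_proj_unique:
  assumes S: "closed_csubspace S" and "g \<in> S" "\<And>h. h \<in> S \<Longrightarrow> cinner (f - g) h = 0"
  shows "orth_proj S f = g"
  unfolding orth_proj_def
proof (rule the_equality)
  fix g' assume g': "g' \<in> S \<and> (\<forall>h\<in>S. cinner (f - g') h = 0)"
  then have "g' - g \<in> S" using closed_csubspace_diff[OF S] assms(2) by blast
  then have "cinner ((f - g) - (f - g')) (g' - g) = 0"
    unfolding cinner_diff_left[of "f - g"] using g' assms(3) by simp
  then show "g' = g" by (auto dest: cinner_self_eq_0)
qed (use assms in auto)

text \<open>Orthogonality for the real inner product suffices: on a complex subspace, testing against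
  \<open>\<i> h\<close> recovers the imaginary part of \<open>\<langle>f - g, h\<rangle>\<close>.\<close>

lemma orth_proj:
  assumes S: "closed_csubspace S"
  shows orth_proj_in: "orth_proj S f \<in> S"
    and orth_proj_orthogonal: "h \<in> S \<Longrightarrow> cinner (f - orth_proj S f) h = 0"
proof -
  obtain g where g: "g \<in> S" "\<And>h. h \<in> S \<Longrightarrow> inner (f - g) h = 0"
    using orthogonal_projection_exists[of S f] S closed_csubspace_imp_subspace
    by (auto simp: closed_csubspace_def)
  have orth: "cinner (f - g) h = 0" if "h \<in> S" for h
  proof -
    have "scaleC \<i> h \<in> S" using S that by (simp add: closed_csubspace_def)
    then have "Re (cinner (f - g) (scaleC \<i> h)) = 0" using g(2) by (simp add: inner_l2_def)
    moreover have "cinner (f - g) (scaleC \<i> h) = - \<i> * cinner (f - g) h"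
      by (subst (1 2) cinner_commute) (simp add: cinner_scaleC_left)
    ultimately show ?thesis using g(2)[OF that] by (simp add: complex_eq_iff inner_l2_def)
  qed
  have "orth_proj S f = g" by (rule orth_proj_unique[OF S g(1) orth])
  then show "orth_proj S f \<in> S" "h \<in> S \<Longrightarrow> cinner (f - orth_proj S f) h = 0"
    using g(1) orth by auto
qed

lemma orth_proj_id: "closed_csubspace S \<Longrightarrow> f \<in> S \<Longrightarrow> orth_proj S f = f"
  by (rule orth_proj_unique) (auto simp: cinner_zero_left)

lemma orth_proj_add:
  assumes S: "closed_csubspace S"
  shows "orth_proj S (f + g) = orth_proj S f + orth_proj S g"
proof (rule orth_proj_unique[OF S])
  show "orth_proj S f + orth_proj S g \<in> S"
    using S orth_proj_in[OF S] by (simp add: closed_csubspace_def)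
  fix h assume "h \<in> S"
  have "f + g - (orth_proj S f + orth_proj S g) = (f - orth_proj S f) + (g - orth_proj S g)"
    by simp
  then show "cinner (f + g - (orth_proj S f + orth_proj S g)) h = 0"
    using orth_proj_orthogonal[OF S \<open>h \<in> S\<close>] by (simp only: cinner_add_left) simp
qed

lemma orth_proj_scaleC:
  assumes S: "closed_csubspace S"
  shows "orth_proj S (scaleC c f) = scaleC c (orth_proj S f)"
proof (rule orth_proj_unique[OF S])
  show "scaleC c (orth_proj S f) \<in> S"
    using S orth_proj_in[OF S] by (simp add: closed_csubspace_def)
  fix h assume "h \<in> S"
  then show "cinner (scaleC c f - scaleC c (orth_proj S f)) h = 0"
    using orth_proj_orthogonal[OF S] by (simp add: cinner_scaleC_left flip: scaleC_diff)
qed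

lemma norm_orth_proj_le:
  assumes S: "closed_csubspace S"
  shows "norm (orth_proj S f) \<le> norm f"
proof -
  let ?g = "orth_proj S f"
  have "inner (f - ?g) ?g = 0"
    using orth_proj_orthogonal[OF S orth_proj_in[OF S]] by (simp add: inner_l2_def)
  then have "(norm ?g)\<^sup>2 = inner f ?g"
    by (simp add: power2_norm_eq_inner inner_diff_left)
  also have "\<dots> \<le> norm f * norm ?g" by (rule norm_cauchy_schwarz)
  finally have "norm ?g * norm ?g \<le> norm f * norm ?g" by (simp add: power2_eq_square)
  then show ?thesis by (cases "norm ?g = 0") (auto simp: mult_le_cancel_right)
qed

section \<open>Multiplication operators\<close>

lemma Linf_cnj: "p \<in> Linf \<Longrightarrow> (\<lambda>z. cnj (p z)) \<in> Linf"
  by (auto simp: Linf_def borel_measurable_cnj_l2)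

lemma square_integrable_mult_Linf:
  "p \<in> Linf \<Longrightarrow> square_integrable f \<Longrightarrow> square_integrable (\<lambda>z. p z * f z)"
  by (auto simp: Linf_def intro: square_integrable_mult_bounded)

lemma mult_op_abs:
  "p \<in> Linf \<Longrightarrow> square_integrable f \<Longrightarrow> mult_op p (abs_l2 f) = abs_l2 (\<lambda>z. p z * f z)"
  by (simp add: mult_op.abs_eq l2_rel_refl)

lemma mult_op_add: "mult_op p (f + g) = mult_op p f + mult_op p g"
proof (cases "p \<in> Linf")
  case True
  then show ?thesis
    by transfer (simp add: l2_rel_def distrib_left square_integrable_add square_integrable_mult_Linf)
next
  case False
  then show ?thesis by transfer (simp add: l2_rel_def square_integrable_zero)
qed

lemma mult_op_scaleC: "mult_op p (scaleC c f) = scaleC c (mult_op p f)"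
proof (cases "p \<in> Linf")
  case True
  then show ?thesis
    by transfer
      (simp add: l2_rel_def mult.left_commute square_integrable_cmult square_integrable_mult_Linf)
next
  case False
  then show ?thesis by transfer (simp add: l2_rel_def square_integrable_zero)
qed

lemma mult_op_diff: "mult_op p (f - g) = mult_op p f - mult_op p g"
  using mult_op_add[of p "f - g" g] by simp

lemma norm_mult_op_bounded:
  assumes "p \<in> Linf"
  obtains C where "\<And>f. norm (mult_op p f) \<le> C * norm f"
proof -
  obtain C where [measurable]: "p \<in> borel_measurable circle_measure"
    and C: "AE z in circle_measure. cmod (p z) \<le> C"
    using assms by (auto simp: Linf_def)
  have "norm (mult_op p x) \<le> \<bar>C\<bar> * norm x" for x
  proof -
    obtain f where f: "square_integrable f" "x = abs_l2 f" by (rule l2_cases)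
    then have [measurable]: "f \<in> borel_measurable circle_measure"
      by (simp add: square_integrable_def)
    have "ennreal ((norm (mult_op p x))\<^sup>2) = (\<integral>\<^sup>+ z. ennreal ((cmod (p z * f z))\<^sup>2) \<partial>circle_measure)"
      using f assms by (simp add: mult_op_abs nn_integral_norm_l2 square_integrable_mult_Linf)
    also have "\<dots> \<le> (\<integral>\<^sup>+ z. ennreal (C\<^sup>2) * ennreal ((cmod (f z))\<^sup>2) \<partial>circle_measure)"
    proof (rule nn_integral_mono_AE, use C in eventually_elim)
      case (elim z)
      then have "(cmod (p z * f z))\<^sup>2 \<le> C\<^sup>2 * (cmod (f z))\<^sup>2"
        by (auto simp: norm_mult power_mult_distrib intro!: mult_right_mono power_mono)
      then show ?case
        by (subst ennreal_mult[symmetric]) (auto intro: ennreal_leI)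
    qed
    also have "\<dots> = ennreal (C\<^sup>2) * (\<integral>\<^sup>+ z. ennreal ((cmod (f z))\<^sup>2) \<partial>circle_measure)"
      by (rule nn_integral_cmult) measurable
    also have "\<dots> = ennreal ((\<bar>C\<bar> * norm x)\<^sup>2)"
      using f by (simp add: nn_integral_norm_l2 power_mult_distrib ennreal_mult)
    finally have "(norm (mult_op p x))\<^sup>2 \<le> (\<bar>C\<bar> * norm x)\<^sup>2" by simp
    then show ?thesis by (rule power2_le_imp_le) simp
  qed
  then show ?thesis by (rule that)
qed

lemma cinner_mult_op:
  assumes "p \<in> Linf"
  shows "cinner (mult_op p f) g = cinner f (mult_op (\<lambda>z. cnj (p z)) g)"
  using assms Linf_cnj[OF assms] by transfer (simp add: mult_ac)

lemma mult_op_inverse: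
  assumes "p \<in> Linf" "q \<in> Linf" "AE z in circle_measure. p z * q z = 1"
  shows "mult_op p (mult_op q f) = f"
proof -
  obtain u where u: "square_integrable u" "f = abs_l2 u" by (rule l2_cases)
  have "l2_rel (\<lambda>z. p z * (q z * u z)) u"
    unfolding l2_rel_def
  proof (intro conjI)
    show "AE z in circle_measure. p z * (q z * u z) = u z"
      using assms(3) by eventually_elim (simp flip: mult.assoc)
  qed (use u assms in \<open>auto intro: square_integrable_mult_Linf\<close>)
  then have "abs_l2 (\<lambda>z. p z * (q z * u z)) = abs_l2 u"
    by (rule Quotient3_rel_abs[OF Quotient3_l2])
  then show ?thesis
    using u assms by (simp add: mult_op_abs square_integrable_mult_Linf)
qed

lemma GLinf_facts:
  assumes "a \<in> GLinf"
  shows "a \<in> Linf" "(\<lambda>z. 1 / a z) \<in> Linf" "(\<lambda>z. cnj (a z)) \<in> Linf" "(\<lambda>z. 1 / cnj (a z)) \<in> Linf"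
    and "mult_op (\<lambda>z. 1 / a z) (mult_op a f) = f" "mult_op a (mult_op (\<lambda>z. 1 / a z) f) = f"
    and "mult_op (\<lambda>z. 1 / cnj (a z)) (mult_op (\<lambda>z. cnj (a z)) f) = f"
proof -
  show *: "a \<in> Linf" "(\<lambda>z. 1 / a z) \<in> Linf" and c: "(\<lambda>z. cnj (a z)) \<in> Linf"
    using assms by (auto simp: GLinf_def Linf_cnj)
  show ci: "(\<lambda>z. 1 / cnj (a z)) \<in> Linf"
    using Linf_cnj[OF *(2)] by simp
  have nz: "AE z in circle_measure. a z \<noteq> 0" using assms by (simp add: GLinf_def)
  show "mult_op (\<lambda>z. 1 / a z) (mult_op a f) = f"
    by (rule mult_op_inverse[OF *(2,1)], use nz in eventually_elim) simp
  show "mult_op a (mult_op (\<lambda>z. 1 / a z) f) = f"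
    by (rule mult_op_inverse[OF *], use nz in eventually_elim) simp
  show "mult_op (\<lambda>z. 1 / cnj (a z)) (mult_op (\<lambda>z. cnj (a z)) f) = f"
    by (rule mult_op_inverse[OF ci c], use nz in eventually_elim) simp
qed

text \<open>The hypotheses on \<open>(a, K, H)\<close> pass to \<open>(1 / a, H, K)\<close>, so each one-sided statement yields its
  mirror image.\<close>

lemma GLinf_inverse:
  assumes "a \<in> GLinf" and "mult_op a ` K = H"
  shows "(\<lambda>z. 1 / a z) \<in> GLinf" "mult_op (\<lambda>z. 1 / a z) ` H = K"
proof -
  show "(\<lambda>z. 1 / a z) \<in> GLinf" using assms(1) by (simp add: GLinf_def)
  have "mult_op (\<lambda>z. 1 / a z) ` H = (\<lambda>f. mult_op (\<lambda>z. 1 / a z) (mult_op a f)) ` K"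
    using assms(2) by (auto simp: image_image)
  then show "mult_op (\<lambda>z. 1 / a z) ` H = K"
    by (simp add: GLinf_facts[OF assms(1)])
qed

section \<open>Generalized Toeplitz operators\<close>

lemma bounded_op_gen_toeplitz:
  assumes M: "closed_csubspace M" and N: "closed_csubspace N" and "p \<in> Linf"
  shows "bounded_op M N (gen_toeplitz M N p)"
proof -
  obtain C where C: "\<And>f. norm (mult_op p f) \<le> C * norm f"
    using norm_mult_op_bounded[OF assms(3)] by blast
  have "norm (gen_toeplitz M N p f) \<le> C * norm f" if "f \<in> M" for f
    using that order_trans[OF norm_orth_proj_le[OF N] C] by (simp add: gen_toeplitz_def)
  then show ?thesis
    using M unfolding bounded_op_def
    by (auto simp: gen_toeplitz_def closed_csubspace_def mult_op_add mult_op_scaleC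
        orth_proj_add[OF N] orth_proj_scaleC[OF N] orth_proj_in[OF N])
qed

lemma gen_toeplitz_eq_mult_op:
  assumes "closed_csubspace N" "mult_op p ` M \<subseteq> N"
  shows "gen_toeplitz M N p = restrict (mult_op p) M"
  unfolding gen_toeplitz_def using assms by (intro restrict_ext orth_proj_id) auto

text \<open>The error \<open>?g - ?u\<close> made by projecting to \<open>K\<close> is orthogonal to \<open>K\<close>, and multiplication by
  \<open>1 / cnj a\<close> moves it into the orthogonal complement of \<open>H\<close>, since its adjoint, multiplication by
  \<open>1 / a\<close>, maps \<open>H\<close> into \<open>K\<close>. The final projection to \<open>H\<close> therefore removes it.\<close>

lemma gen_toeplitz_cnj_left_inverse:
  assumes H: "closed_csubspace H" and K: "closed_csubspace K"
    and a: "a \<in> GLinf" "mult_op a ` K = H" and f: "f \<in> H"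
  shows "gen_toeplitz K H (\<lambda>z. 1 / cnj (a z)) (gen_toeplitz H K (\<lambda>z. cnj (a z)) f) = f"
proof -
  let ?q = "\<lambda>z. 1 / cnj (a z)"
  let ?u = "mult_op (\<lambda>z. cnj (a z)) f"
  let ?g = "orth_proj K ?u"
  have "orth_proj H (mult_op ?q ?g) = f"
  proof (rule orth_proj_unique[OF H f])
    fix h assume "h \<in> H"
    then obtain k where k: "k \<in> K" "h = mult_op a k" using a(2) by auto
    have "cinner (mult_op ?q ?g - f) h = cinner (mult_op ?q (?g - ?u)) h"
      by (simp add: mult_op_diff GLinf_facts[OF a(1)])
    also have "\<dots> = cinner (?g - ?u) k"
      by (simp add: k(2) cinner_mult_op GLinf_facts[OF a(1)])
    also have "\<dots> = 0"
      using orth_proj_orthogonal[OF K k(1), of ?u] by (simp add: cinner_diff_left)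
    finally show "cinner (mult_op ?q ?g - f) h = 0" .
  qed
  then show ?thesis
    using f orth_proj_in[OF K] by (simp add: gen_toeplitz_def)
qed

lemma invertible_opI:
  assumes T: "bounded_op M N T" and S: "bounded_op N M S"
    and ST: "\<And>f. f \<in> M \<Longrightarrow> S (T f) = f" and TS: "\<And>g. g \<in> N \<Longrightarrow> T (S g) = g"
  shows "invertible_op M N T" "inverse_op M N T = S"
proof -
  have maps: "T \<in> M \<rightarrow> N" "S \<in> N \<rightarrow>\<^sub>E M"
    using T S by (auto simp: bounded_op_def)
  have bij: "bij_betw T M N"
    using maps ST TS by (intro bij_betw_byWitness[where f' = S]) auto
  show inv: "inverse_op M N T = S"
  proof
    fix g
    show "inverse_op M N T g = S g"
    proof (cases "g \<in> N")
      case True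
      then have "inv_into M T g = S g"
        using maps TS bij by (intro inv_into_f_eq) (auto simp: bij_betw_def)
      with True show ?thesis by (simp add: inverse_op_def)
    next
      case False
      with maps show ?thesis by (auto simp: inverse_op_def)
    qed
  qed
  show "invertible_op M N T"
    using T S bij by (simp add: invertible_op_def inv)
qed

text \<open>Both projections disappear inside the inner product, because each is paired with a vector of
  the subspace onto which it projects; what remains is the adjoint relation for multiplication.\<close>

lemma adjoint_gen_toeplitz:
  assumes M: "closed_csubspace M" and N: "closed_csubspace N" and p: "p \<in> Linf"
  shows "adjoint_op M N (gen_toeplitz M N p) = gen_toeplitz N M (\<lambda>z. cnj (p z))"
  unfolding adjoint_op_def gen_toeplitz_def[of N M]
proof (rule restrict_ext)
  fix g assume g: "g \<in> N"
  let ?h = "orth_proj M (mult_op (\<lambda>z. cnj (p z)) g)"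
  have adj: "cinner (gen_toeplitz M N p f) g = cinner f ?h" if "f \<in> M" for f
  proof -
    have "cinner (gen_toeplitz M N p f) g = cinner (mult_op p f) g"
      using that orth_proj_orthogonal[OF N g, of "mult_op p f"]
      by (simp add: gen_toeplitz_def cinner_diff_left)
    also have "\<dots> = cinner f (mult_op (\<lambda>z. cnj (p z)) g)"
      by (rule cinner_mult_op[OF p])
    also have "\<dots> = cinner f ?h"
      using orth_proj_orthogonal[OF M that, of "mult_op (\<lambda>z. cnj (p z)) g"]
      by (subst (1 2) cinner_commute) (simp add: cinner_diff_left)
    finally show ?thesis .
  qed
  show "(THE h. h \<in> M \<and> (\<forall>f\<in>M. cinner (gen_toeplitz M N p f) g = cinner f h)) = ?h"
  proof (rule the_equality)
    show "?h \<in> M \<and> (\<forall>f\<in>M. cinner (gen_toeplitz M N p f) g = cinner f ?h)"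
      using adj orth_proj_in[OF M] by auto
    fix h assume h: "h \<in> M \<and> (\<forall>f\<in>M. cinner (gen_toeplitz M N p f) g = cinner f h)"
    then have "h - ?h \<in> M" using closed_csubspace_diff[OF M] orth_proj_in[OF M] by blast
    then have "cinner (h - ?h) (h - ?h) = 0"
      using h adj by (simp add: cinner_diff_right[of _ h])
    then show "h = ?h" by (auto dest: cinner_self_eq_0)
  qed
qed

theorem proposition2p9:
  fixes H K :: "l2 set" and a :: "complex \<Rightarrow> complex"
  assumes "closed_csubspace H" and "closed_csubspace K"
    and "a \<in> GLinf" and "mult_op a ` K = H"
  shows
    "gen_toeplitz K H a = restrict (mult_op a) K \<and>
     gen_toeplitz K H (\<lambda>z. 1 / cnj (a z)) =
       (\<lambda>f\<in>K. orth_proj H (mult_op (\<lambda>z. 1 / cnj (a z)) (orth_proj K f))) \<and>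
     invertible_op K H (gen_toeplitz K H a) \<and>
     invertible_op K H (gen_toeplitz K H (\<lambda>z. 1 / cnj (a z))) \<and>
     inverse_op K H (gen_toeplitz K H a) = gen_toeplitz H K (\<lambda>z. 1 / a z) \<and>
     inverse_op K H (gen_toeplitz K H (\<lambda>z. 1 / cnj (a z))) = gen_toeplitz H K (\<lambda>z. cnj (a z)) \<and>
     (\<lambda>z. 1 / cnj (a z)) \<in> Linf \<and> (\<lambda>z. 1 / a z) \<in> Linf \<and> (\<lambda>z. cnj (a z)) \<in> Linf \<and>
     invertible_op H K (adjoint_op K H (gen_toeplitz K H a)) \<and>
     gen_toeplitz K H (\<lambda>z. 1 / cnj (a z)) = inverse_op H K (adjoint_op K H (gen_toeplitz K H a))"
proof -
  note H = assms(1) and K = assms(2) and a = assms(3,4)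
  note inv = GLinf_inverse[OF a] and facts = GLinf_facts[OF a(1)]
  have Ta: "gen_toeplitz K H a = restrict (mult_op a) K"
    using a(2) by (intro gen_toeplitz_eq_mult_op H) auto
  have Tai: "gen_toeplitz H K (\<lambda>z. 1 / a z) = restrict (mult_op (\<lambda>z. 1 / a z)) H"
    using inv(2) by (intro gen_toeplitz_eq_mult_op K) auto
  have one: "invertible_op K H (gen_toeplitz K H a)"
      "inverse_op K H (gen_toeplitz K H a) = gen_toeplitz H K (\<lambda>z. 1 / a z)"
  proof -
    have "gen_toeplitz H K (\<lambda>z. 1 / a z) (gen_toeplitz K H a f) = f" if "f \<in> K" for f
      using that a(2) by (auto simp: Ta Tai facts)
    moreover have "gen_toeplitz K H a (gen_toeplitz H K (\<lambda>z. 1 / a z) g) = g" if "g \<in> H" for g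
      using that inv(2) by (auto simp: Ta Tai facts)
    ultimately show "invertible_op K H (gen_toeplitz K H a)"
      "inverse_op K H (gen_toeplitz K H a) = gen_toeplitz H K (\<lambda>z. 1 / a z)"
      using invertible_opI[OF bounded_op_gen_toeplitz[OF K H facts(1)]
          bounded_op_gen_toeplitz[OF H K facts(2)]] by auto
  qed
  have left: "gen_toeplitz K H (\<lambda>z. 1 / cnj (a z)) (gen_toeplitz H K (\<lambda>z. cnj (a z)) f) = f"
    if "f \<in> H" for f
    using gen_toeplitz_cnj_left_inverse[OF H K a that] .
  have right: "gen_toeplitz H K (\<lambda>z. cnj (a z)) (gen_toeplitz K H (\<lambda>z. 1 / cnj (a z)) f) = f"
    if "f \<in> K" for f
    using gen_toeplitz_cnj_left_inverse[OF K H inv that] by simp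
  note bounded = bounded_op_gen_toeplitz[OF K H facts(4)] bounded_op_gen_toeplitz[OF H K facts(3)]
  note two = invertible_opI[OF bounded right left]
  note three = invertible_opI[OF bounded(2,1) left right]
  have proj: "gen_toeplitz K H (\<lambda>z. 1 / cnj (a z)) =
      (\<lambda>f\<in>K. orth_proj H (mult_op (\<lambda>z. 1 / cnj (a z)) (orth_proj K f)))"
    unfolding gen_toeplitz_def by (intro restrict_ext) (simp add: orth_proj_id[OF K])
  show ?thesis
    unfolding adjoint_gen_toeplitz[OF K H facts(1)]
    by (intro conjI Ta proj one two three(1) three(2)[symmetric] facts)
qed

end
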